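(* Let $n,k,r$ be positive integers and $p,b$ non-negative integers with $r\le p+1$. Put $$D(n,k,r,b,p)=\det\left(\binom{(n-i+1)p+b-i+j+k+(i-1)r}{k+(i-1)r}\right)_{1\le i,j\le n+1}.$$ Then $$D(n,k,r,b,p)=\prod_{(i,j)\in\mathcal{A}_{n,k,r}}\frac{i+b+jp}{i}\ \prod_{(i,j)\in\mathcal{B}_{n,k,r}}\frac{(k-i+1)(p+1)+(i+j-1)r+r(b+np)}{k-i+1+(i+j-1)r},$$ where $$\mathcal{A}_{n,k,r}=\{(i,j)\in\mathbb{Z}_{\ge0}^2\ |\ j\le n,\ j<i\le k+(r-1)(n-j)\},$$ $$\mathcal{B}_{n,k,r}=\{(i,j)\in\mathbb{Z}_{\ge1}^2\ |\ i+j\le n+1,\ i\ne k+1+rs\ \text{for all}\ s\in\mathbb{Z}_{\ge0}\}.$$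
   Context: Binomial coefficients $\binom{a}{c}$ with $0\le a<c$ are zero. (The number $D(n,k,r,b,p)$ is the value at $x_1=x_2=\cdots=1$ of the Schubert polynomial of the unique vexillary permutation with shape $\lambda_i=(n-i+1)p+b$ and flag $\phi_i=k+1+r(i-1)$, $1\le i\le n+1-\delta_{b,0}$.) *)

theory Defs
  imports "Jordan_Normal_Form.Determinant"
begin

(* Rows and columns are numbered from 1.  For 1 <= i <= n + 1, j >= 1 and
   r >= 1 no subtraction below truncates (see int_upper_entry), and the library's choose
   is zero when the upper index is below the lower one. *)
definition upper_entry :: "nat \<Rightarrow> nat \<Rightarrow> nat \<Rightarrow> nat \<Rightarrow> nat \<Rightarrow> nat \<Rightarrow> nat \<Rightarrow> nat" where
  "upper_entry n k r b p i j = (n + 1 - i) * p + b + j + k + (i - 1) * r - i"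

(* Rows and columns of mat are numbered from 0, hence the shift by 1. *)
definition D_matrix :: "nat \<Rightarrow> nat \<Rightarrow> nat \<Rightarrow> nat \<Rightarrow> nat \<Rightarrow> rat mat" where
  "D_matrix n k r b p = mat (n + 1) (n + 1) (\<lambda>(i0, j0).
     let i = i0 + 1; j = j0 + 1
     in of_nat (upper_entry n k r b p i j choose (k + (i - 1) * r)))"

definition D :: "nat \<Rightarrow> nat \<Rightarrow> nat \<Rightarrow> nat \<Rightarrow> nat \<Rightarrow> rat" where
  "D n k r b p = det (D_matrix n k r b p)"

(* The natural-number subtractions are exact: j <= n, and r >= 1 in the theorem. *)
definition A_set :: "nat \<Rightarrow> nat \<Rightarrow> nat \<Rightarrow> (nat \<times> nat) set" where
  "A_set n k r = {(i, j). j \<le> n \<and> j < i \<and> i \<le> k + (r - 1) * (n - j)}"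

definition B_set :: "nat \<Rightarrow> nat \<Rightarrow> nat \<Rightarrow> (nat \<times> nat) set" where
  "B_set n k r = {(i, j). 1 \<le> i \<and> 1 \<le> j \<and> i + j \<le> n + 1 \<and> (\<forall>s::nat. i \<noteq> k + 1 + r * s)}"

lemma int_upper_entry:
  assumes "1 \<le> i" "i \<le> n + 1" "1 \<le> j" "1 \<le> r"
  shows "int (upper_entry n k r b p i j) =
    (int n - int i + 1) * int p + int b - int i + int j + int k + (int i - 1) * int r"
proof -
  have "(i - 1) * 1 \<le> (i - 1) * r"
    using assms by (intro mult_le_mono2) simp
  then have le: "i \<le> (n + 1 - i) * p + b + j + k + (i - 1) * r"
    using assms by linarith
  have "int (n + 1 - i) = int n - int i + 1" "int (i - 1) = int i - 1"
    using assms by linarith+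
  then show ?thesis
    unfolding upper_entry_def of_nat_diff[OF le] of_nat_add of_nat_mult by simp
qed

(* Both index sets are finite, so the products over them are genuine, and the denominators
   indexed by B_set do not vanish. *)
lemma finite_A_set: "finite (A_set n k r)"
proof -
  have "i \<le> k + (r - 1) * n" if "i \<le> k + (r - 1) * (n - j)" for i j
    using that mult_le_mono2[of "n - j" n "r - 1"] by linarith
  then have "A_set n k r \<subseteq> {..k + (r - 1) * n} \<times> {..n}"
    unfolding A_set_def by blast
  then show ?thesis
    by (rule finite_subset) simp
qed

lemma finite_B_set: "finite (B_set n k r)"
proof -
  have "B_set n k r \<subseteq> {..n + 1} \<times> {..n + 1}"
    unfolding B_set_def by auto
  then show ?thesis
    by (rule finite_subset) simp
qed

lemma B_denominator_nonzero:
  assumes "(i, j) \<in> B_set n k r" "1 \<le> r"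
  shows "rat_of_nat k - of_nat i + 1 + (of_nat i + of_nat j - 1) * of_nat r \<noteq> 0"
proof -
  have ij: "1 \<le> i" "1 \<le> j"
    using assms(1) by (auto simp: B_set_def)
  define x where "x = (rat_of_nat i + of_nat j - 1) * of_nat r"
  have "(rat_of_nat i + of_nat j - 1) * 1 \<le> x"
    unfolding x_def using ij assms(2)
    by (intro mult_left_mono) (auto simp flip: of_nat_add)
  then have "rat_of_nat k + of_nat j \<le> of_nat k - of_nat i + 1 + x"
    by (simp add: algebra_simps)
  moreover have "0 < rat_of_nat k + of_nat j"
    using ij by (simp flip: of_nat_add)
  ultimately have "0 < rat_of_nat k - of_nat i + 1 + x"
    by (rule less_le_trans[rotated])
  then show ?thesis by (simp add: x_def)
qed

end

theory Submission
  imports Defs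
begin

text \<open>
  Every entry of the matrix is a row factor times a product of \<open>n\<close> linear forms in the row index,
  and this makes the determinant an instance of Krattenthaler's formula.

  Let \<open>y\<close> and \<open>j\<close> be the row and column index, both counted from the end, starting with \<open>0\<close>.
  With \<open>m = k + (n - y) r\<close> and \<open>Y = y (p + 1) + b\<close> the entry is the binomial coefficient
  \<open>m + Y - j\<close> over \<open>m\<close>. It equals a factor depending on \<open>y\<close> alone times
  \<^item> the falling product \<open>Y (Y - 1) \<dots> (Y - j + 1)\<close>, and
  \<^item> the product of \<open>m + Y - l\<close> over \<open>j \<le> l < n\<close>.

  Both \<open>Y\<close> and \<open>m + Y\<close> are affine in \<open>y\<close>. Going from one column to the next, one linear form of the
  second family is exchanged for one of the first, and \<open>det_krattenthaler\<close> evaluates such a determinant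
  as a Vandermonde product times the resultants of the pairs \<open>j \<le> l < n\<close> of linear forms.
  These resultants are exactly the numerators of the second product of the theorem, taken over the
  full staircase \<open>i + j \<le> n + 1\<close> (\<open>D_eq_product\<close>).

  The rest is a comparison of factorials. The denominators over one diagonal of the staircase multiply
  to a quotient of factorials, and so do the factors of the first product in one column \<open>j\<close>,
  which run over \<open>j < i \<le> M\<close> with \<open>M = k + (r - 1) (n - j)\<close>. If \<open>M < j\<close>, the quotient of factorials for
  column \<open>j\<close> is not a product over an empty range: it is the reciprocal of a product over \<open>M < i \<le> j\<close>.
  The cells \<open>(i, j)\<close> with \<open>M < i \<le> j\<close> correspond bijectively to the cells of the staircase whose row is of
  the form \<open>k + 1 + r s\<close>, and the factors at corresponding cells agree
  (\<open>prod_columns_eq_A_over_deficit\<close>, \<open>prod_staircase_eq_B_times_deficit\<close>). So the reciprocals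
  cancel precisely the part of the staircase that is missing from the second index set.
\<close>

section \<open>Determinants of triangular products and of reversed matrices\<close>

lemma det_mat_upper_triangular:
  fixes u :: "nat \<Rightarrow> nat \<Rightarrow> 'a::idom"
  assumes "\<And>i j. j < i \<Longrightarrow> i < N \<Longrightarrow> u i j = 0"
  shows "det (mat N N (\<lambda>(i, j). u i j)) = (\<Prod>i<N. u i i)"
proof -
  have "det (mat N N (\<lambda>(i, j). u i j)) = prod_list (diag_mat (mat N N (\<lambda>(i, j). u i j)))"
    using assms by (intro det_upper_triangular[where n = N]) auto
  then show ?thesis
    by (simp add: prod_list_diag_prod lessThan_atLeast0)
qed

lemma det_mat_lower_triangular:
  fixes u :: "nat \<Rightarrow> nat \<Rightarrow> 'a::idom"
  assumes "\<And>i j. i < j \<Longrightarrow> j < N \<Longrightarrow> u i j = 0"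
  shows "det (mat N N (\<lambda>(i, j). u i j)) = (\<Prod>i<N. u i i)"
proof -
  have "det (mat N N (\<lambda>(i, j). u i j)) = prod_list (diag_mat (mat N N (\<lambda>(i, j). u i j)))"
    using assms by (intro det_lower_triangular[where n = N]) auto
  then show ?thesis
    by (simp add: prod_list_diag_prod lessThan_atLeast0)
qed

lemma det_mat_sum_product:
  fixes g u :: "nat \<Rightarrow> nat \<Rightarrow> 'a::comm_ring_1"
  shows "det (mat N N (\<lambda>(i, j). \<Sum>s<N. g i s * u s j)) =
    det (mat N N (\<lambda>(i, j). g i j)) * det (mat N N (\<lambda>(i, j). u i j))"
proof -
  have "mat N N (\<lambda>(i, j). \<Sum>s<N. g i s * u s j) =
      mat N N (\<lambda>(i, j). g i j) * mat N N (\<lambda>(i, j). u i j)"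
    by (intro eq_matI) (auto simp: scalar_prod_def lessThan_atLeast0)
  then show ?thesis
    by (simp add: det_mult[where n = N])
qed

lemma det_mat_scale_rows:
  fixes a :: "nat \<Rightarrow> 'a::idom"
  shows "det (mat N N (\<lambda>(i, j). a i * g i j)) = (\<Prod>i<N. a i) * det (mat N N (\<lambda>(i, j). g i j))"
proof -
  define d where "d i s = (if i = s then a i else 0)" for i s
  have "(\<Sum>s<N. d i s * g s j) = a i * g i j" if "i < N" for i j
  proof -
    have "(\<Sum>s<N. d i s * g s j) = (\<Sum>s<N. if i = s then a i * g s j else 0)"
      by (intro sum.cong) (auto simp: d_def)
    then show ?thesis using that by simp
  qed
  then have "mat N N (\<lambda>(i, j). a i * g i j) = mat N N (\<lambda>(i, j). \<Sum>s<N. d i s * g s j)"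
    by (intro eq_matI) auto
  moreover have "det (mat N N (\<lambda>(i, j). d i j)) = (\<Prod>i<N. a i)"
    by (subst det_mat_upper_triangular) (auto simp: d_def)
  ultimately show ?thesis
    by (simp add: det_mat_sum_product)
qed

text \<open>Reversing the rows and reversing the columns contribute the same sign, so no sign remains.\<close>
lemma det_mat_reverse:
  fixes f :: "nat \<Rightarrow> nat \<Rightarrow> 'a::comm_ring_1"
  shows "det (mat (Suc n) (Suc n) (\<lambda>(i, j). f (n - i) (n - j))) =
    det (mat (Suc n) (Suc n) (\<lambda>(i, j). f i j))"
proof -
  define \<rho> where "\<rho> i = (if i \<le> n then n - i else i)" for i
  have "bij_betw \<rho> {0..<Suc n} {0..<Suc n}"
    by (rule bij_betw_byWitness[where f' = \<rho>]) (auto simp: \<rho>_def)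
  then have perm: "\<rho> permutes {0..<Suc n}"
    by (rule bij_imp_permutes) (auto simp: \<rho>_def)
  have rows: "det (mat (Suc n) (Suc n) (\<lambda>(i, j). h (n - i) j)) =
      signof \<rho> * det (mat (Suc n) (Suc n) (\<lambda>(i, j). h i j))" for h :: "nat \<Rightarrow> nat \<Rightarrow> 'a"
  proof -
    have "mat (Suc n) (Suc n) (\<lambda>(i, j). h (n - i) j) =
        mat (Suc n) (Suc n) (\<lambda>(i, j). mat (Suc n) (Suc n) (\<lambda>(i, j). h i j) $$ (\<rho> i, j))"
      by (intro eq_matI) (auto simp: \<rho>_def)
    then show ?thesis
      using det_permute_rows[OF _ perm, of "mat (Suc n) (Suc n) (\<lambda>(i, j). h i j)"] by simp
  qed
  have transp: "det (mat (Suc n) (Suc n) (\<lambda>(i, j). h j i)) =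
      det (mat (Suc n) (Suc n) (\<lambda>(i, j). h i j))" for h :: "nat \<Rightarrow> nat \<Rightarrow> 'a"
  proof -
    have "mat (Suc n) (Suc n) (\<lambda>(i, j). h j i) =
        transpose_mat (mat (Suc n) (Suc n) (\<lambda>(i, j). h i j))"
      by (intro eq_matI) auto
    then show ?thesis
      by (simp add: det_transpose[where n = "Suc n"])
  qed
  have "det (mat (Suc n) (Suc n) (\<lambda>(i, j). f (n - i) (n - j))) =
      signof \<rho> * det (mat (Suc n) (Suc n) (\<lambda>(i, j). f i (n - j)))"
    by (rule rows)
  also have "det (mat (Suc n) (Suc n) (\<lambda>(i, j). f i (n - j))) =
      det (mat (Suc n) (Suc n) (\<lambda>(i, j). f j (n - i)))"
    by (rule transp)
  also have "\<dots> = signof \<rho> * det (mat (Suc n) (Suc n) (\<lambda>(i, j). f j i))"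
    by (rule rows)
  also have "det (mat (Suc n) (Suc n) (\<lambda>(i, j). f j i)) =
      det (mat (Suc n) (Suc n) (\<lambda>(i, j). f i j))"
    by (rule transp)
  finally show ?thesis
    by (simp add: sign_def)
qed

section \<open>Krattenthaler's determinant\<close>

text \<open>
  The products of the first \<open>t\<close> linear forms \<open>\<gamma> x + c l\<close> are a Newton basis with nodes \<open>- c l / \<gamma>\<close>.
  A product of \<open>d\<close> linear forms has degree at most \<open>d\<close>, so it is a combination of the first \<open>d + 1\<close>
  of them. Only the two extreme coefficients enter the determinants below: the first is the value at the
  node \<open>- c 0 / \<gamma>\<close>, where all other basis elements vanish, and the last compares leading coefficients.
\<close>
lemma linear_product_in_newton_basis:
  fixes \<alpha> \<gamma> :: "'a::field"
  assumes "\<gamma> \<noteq> 0"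
  shows "\<exists>u. (\<forall>x. (\<Prod>l<d. \<alpha> * x + \<beta> l) = (\<Sum>t\<le>d. u t * (\<Prod>l<t. \<gamma> * x + c l))) \<and>
    u 0 = (\<Prod>l<d. \<beta> l - \<alpha> * c 0 / \<gamma>) \<and> u d = (\<alpha> / \<gamma>) ^ d"
proof (induction d)
  case 0
  show ?case by (intro exI[of _ "\<lambda>_. 1"]) auto
next
  case (Suc d)
  then obtain u where u: "\<And>x. (\<Prod>l<d. \<alpha> * x + \<beta> l) = (\<Sum>t\<le>d. u t * (\<Prod>l<t. \<gamma> * x + c l))"
    "u 0 = (\<Prod>l<d. \<beta> l - \<alpha> * c 0 / \<gamma>)" "u d = (\<alpha> / \<gamma>) ^ d"
    by blast
  define \<delta> where "\<delta> t = \<beta> d - \<alpha> * c t / \<gamma>" for t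
  \<comment> \<open>Multiplying by \<open>\<alpha> x + \<beta> d\<close> sends a basis element to \<open>\<alpha> / \<gamma>\<close> times the next one plus \<open>\<delta>\<close> times itself.\<close>
  define v where "v t = (if t \<le> d then \<delta> t * u t else 0) +
    (case t of 0 \<Rightarrow> 0 | Suc t' \<Rightarrow> \<alpha> / \<gamma> * u t')" for t
  have "(\<Prod>l<Suc d. \<alpha> * x + \<beta> l) = (\<Sum>t\<le>Suc d. v t * (\<Prod>l<t. \<gamma> * x + c l))" for x
  proof -
    define e where "e t = (\<Prod>l<t. \<gamma> * x + c l)" for t
    have step: "(\<alpha> * x + \<beta> d) * e t = \<alpha> / \<gamma> * e (Suc t) + \<delta> t * e t" for t
      using assms by (simp add: e_def \<delta>_def field_simps)
    have "(\<Sum>t\<le>Suc d. v t * e t) = (\<Sum>t\<le>Suc d. (if t \<le> d then \<delta> t * u t else 0) * e t) +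
        (\<Sum>t\<le>Suc d. (case t of 0 \<Rightarrow> 0 | Suc t' \<Rightarrow> \<alpha> / \<gamma> * u t') * e t)"
      by (simp only: v_def distrib_right sum.distrib)
    also have "(\<Sum>t\<le>Suc d. (if t \<le> d then \<delta> t * u t else 0) * e t) = (\<Sum>t\<le>d. \<delta> t * u t * e t)"
      by (simp cong: sum.cong_simp)
    also have "(\<Sum>t\<le>Suc d. (case t of 0 \<Rightarrow> 0 | Suc t' \<Rightarrow> \<alpha> / \<gamma> * u t') * e t) =
        (\<Sum>t\<le>d. \<alpha> / \<gamma> * u t * e (Suc t))"
      by (subst sum.atMost_Suc_shift) simp
    also have "(\<Sum>t\<le>d. \<delta> t * u t * e t) + (\<Sum>t\<le>d. \<alpha> / \<gamma> * u t * e (Suc t)) =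
        (\<Sum>t\<le>d. u t * (\<alpha> / \<gamma> * e (Suc t) + \<delta> t * e t))"
      by (simp only: sum.distrib[symmetric]) (intro sum.cong refl, simp only: algebra_simps)
    also have "\<dots> = (\<Sum>t\<le>d. u t * e t) * (\<alpha> * x + \<beta> d)"
      by (simp only: step[symmetric] sum_distrib_right) (intro sum.cong refl, simp only: algebra_simps)
    also have "\<dots> = (\<Prod>l<Suc d. \<alpha> * x + \<beta> l)"
      by (simp add: u(1) e_def)
    finally show ?thesis by (simp add: e_def)
  qed
  moreover have "v 0 = (\<Prod>l<Suc d. \<beta> l - \<alpha> * c 0 / \<gamma>)"
    by (simp add: v_def \<delta>_def u(2) mult.commute)
  moreover have "v (Suc d) = (\<alpha> / \<gamma>) ^ Suc d"
    by (simp add: v_def u(3))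
  ultimately show ?case by blast
qed

text \<open>
  Expanding the columns in the Newton basis whose nodes are the points \<open>x l\<close> themselves factors the matrix
  into a lower triangular matrix, whose diagonal gives the Vandermonde product, and an upper triangular
  one, whose diagonal consists of the leading coefficients.
\<close>
lemma det_newton_basis:
  fixes x c :: "nat \<Rightarrow> 'a::field"
  shows "det (mat N N (\<lambda>(i, j). \<Prod>l<j. \<gamma> * x i + c l)) =
    (\<Prod>i<N. \<Prod>l<i. x i - x l) * (\<Prod>j<N. \<gamma> ^ j)"
proof -
  have "\<exists>u. (\<forall>z. (\<Prod>l<j. \<gamma> * z + c l) = (\<Sum>t\<le>j. u t * (\<Prod>l<t. z - x l))) \<and> u j = \<gamma> ^ j" for j
    using linear_product_in_newton_basis[where \<gamma> = 1 and d = j and \<alpha> = \<gamma> and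
        \<beta> = c and c = "\<lambda>l. - x l"] by auto
  then obtain u where u: "\<And>j z. (\<Prod>l<j. \<gamma> * z + c l) = (\<Sum>t\<le>j. u j t * (\<Prod>l<t. z - x l))"
    "\<And>j. u j j = \<gamma> ^ j"
    by metis
  define U where "U t j = (if t \<le> j then u j t else 0)" for t j
  have "(\<Prod>l<j. \<gamma> * x i + c l) = (\<Sum>t<N. (\<Prod>l<t. x i - x l) * U t j)" if "j < N" for i j
  proof -
    have "(\<Sum>t\<le>j. u j t * (\<Prod>l<t. x i - x l)) = (\<Sum>t\<le>j. (\<Prod>l<t. x i - x l) * U t j)"
      by (intro sum.cong) (auto simp: U_def)
    also have "\<dots> = (\<Sum>t<N. (\<Prod>l<t. x i - x l) * U t j)"
      using that by (intro sum.mono_neutral_left) (auto simp: U_def)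
    finally show ?thesis by (simp add: u(1))
  qed
  then have "mat N N (\<lambda>(i, j). \<Prod>l<j. \<gamma> * x i + c l) =
      mat N N (\<lambda>(i, j). \<Sum>t<N. (\<Prod>l<t. x i - x l) * U t j)"
    by (intro eq_matI) auto
  moreover have "det (mat N N (\<lambda>(i, j). \<Prod>l<j. x i - x l)) = (\<Prod>i<N. \<Prod>l<i. x i - x l)"
    by (rule det_mat_lower_triangular) (auto simp: prod_zero_iff)
  moreover have "det (mat N N (\<lambda>(i, j). U i j)) = (\<Prod>j<N. \<gamma> ^ j)"
    by (subst det_mat_upper_triangular) (auto simp: U_def u(2))
  ultimately show ?thesis
    by (simp add: det_mat_sum_product)
qed

text \<open>
  All columns have the same degree bound \<open>n\<close>, but column \<open>j\<close> is divisible by the \<open>j\<close>-th element \<open>e j\<close> of the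
  Newton basis. Expanding its cofactor in the Newton basis that starts at the node of \<open>c j\<close> writes
  column \<open>j\<close> as a combination of \<open>e j, \<dots>, e n\<close>, so the transition matrix is triangular. Its
  diagonal entries are the values of the cofactors at their first nodes, which are resultants up to powers
  of \<open>\<gamma>\<close>; those powers cancel against the leading coefficients in \<open>det_newton_basis\<close>.
\<close>
lemma det_krattenthaler:
  fixes x c \<beta> :: "nat \<Rightarrow> 'a::field"
  assumes "\<gamma> \<noteq> 0"
  shows "det (mat (Suc n) (Suc n)
      (\<lambda>(i, j). (\<Prod>l<j. \<gamma> * x i + c l) * (\<Prod>l=j..<n. \<alpha> * x i + \<beta> l))) =
    (\<Prod>i\<le>n. \<Prod>l<i. x i - x l) * (\<Prod>j\<le>n. \<Prod>l=j..<n. \<gamma> * \<beta> l - \<alpha> * c j)"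
proof -
  define e where "e t z = (\<Prod>l<t. \<gamma> * z + c l)" for t z
  have "\<exists>u. (\<forall>z. e j z * (\<Prod>l=j..<n. \<alpha> * z + \<beta> l) = (\<Sum>t\<in>{j..n}. e t z * u t)) \<and>
      u j = (\<Prod>l=j..<n. \<beta> l - \<alpha> * c j / \<gamma>)" if "j \<le> n" for j
  proof -
    obtain u where u: "\<And>z. (\<Prod>l<n-j. \<alpha> * z + \<beta> (l + j)) =
          (\<Sum>t\<le>n-j. u t * (\<Prod>l<t. \<gamma> * z + c (l + j)))"
        "u 0 = (\<Prod>l<n-j. \<beta> (l + j) - \<alpha> * c j / \<gamma>)"
      using linear_product_in_newton_basis[OF assms, where d = "n - j" and \<alpha> = \<alpha> and
          \<beta> = "\<lambda>l. \<beta> (l + j)" and c = "\<lambda>l. c (l + j)"]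
      by auto
    have shift: "(\<Prod>l=j..<n. h l) = (\<Prod>l<n-j. h (l + j))" for h :: "nat \<Rightarrow> 'a"
      using that prod.shift_bounds_nat_ivl[of h 0 j "n - j"] by (simp add: lessThan_atLeast0)
    have e_split: "e j z * (\<Prod>l<t. \<gamma> * z + c (l + j)) = e (t + j) z" for t z
      unfolding e_def using prod.shift_bounds_nat_ivl[of "\<lambda>l. \<gamma> * z + c l" 0 j t]
        prod.atLeastLessThan_concat[of 0 j "t + j" "\<lambda>l. \<gamma> * z + c l"]
      by (simp add: lessThan_atLeast0)
    have "e j z * (\<Prod>l=j..<n. \<alpha> * z + \<beta> l) = (\<Sum>t\<in>{j..n}. e t z * u (t - j))" for z
    proof -
      have "e j z * (\<Prod>l=j..<n. \<alpha> * z + \<beta> l) = (\<Sum>t\<le>n-j. e (t + j) z * u t)"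
        by (simp add: shift u(1) sum_distrib_left flip: e_split) (simp add: mult_ac)
      also have "\<dots> = (\<Sum>t\<in>{j..n}. e t z * u (t - j))"
        using that by (intro sum.reindex_bij_witness[of _ "\<lambda>t. t - j" "\<lambda>t. t + j"]) auto
      finally show ?thesis .
    qed
    then show ?thesis
      using u(2) by (intro exI[of _ "\<lambda>t. u (t - j)"]) (simp add: shift)
  qed
  then have "\<forall>j\<in>{..n}. \<exists>u. (\<forall>z. e j z * (\<Prod>l=j..<n. \<alpha> * z + \<beta> l) =
      (\<Sum>t\<in>{j..n}. e t z * u t)) \<and> u j = (\<Prod>l=j..<n. \<beta> l - \<alpha> * c j / \<gamma>)"
    by blast
  from bchoice[OF this] obtain u where u:
      "\<And>j z. j \<le> n \<Longrightarrow> e j z * (\<Prod>l=j..<n. \<alpha> * z + \<beta> l) = (\<Sum>t\<in>{j..n}. e t z * u j t)"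
      "\<And>j. j \<le> n \<Longrightarrow> u j j = (\<Prod>l=j..<n. \<beta> l - \<alpha> * c j / \<gamma>)"
    by auto
  define U where "U t j = (if j \<le> t then u j t else 0)" for t j
  have "e j (x i) * (\<Prod>l=j..<n. \<alpha> * x i + \<beta> l) = (\<Sum>t<Suc n. e t (x i) * U t j)"
    if "j \<le> n" for i j
  proof -
    have "(\<Sum>t\<in>{j..n}. e t (x i) * u j t) = (\<Sum>t\<in>{j..n}. e t (x i) * U t j)"
      by (intro sum.cong) (auto simp: U_def)
    also have "\<dots> = (\<Sum>t<Suc n. e t (x i) * U t j)"
      by (intro sum.mono_neutral_left) (auto simp: U_def)
    finally show ?thesis using that by (simp add: u(1))
  qed
  then have "mat (Suc n) (Suc n)
        (\<lambda>(i, j). e j (x i) * (\<Prod>l=j..<n. \<alpha> * x i + \<beta> l)) =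
      mat (Suc n) (Suc n) (\<lambda>(i, j). \<Sum>t<Suc n. e t (x i) * U t j)"
    by (intro eq_matI) auto
  then have "det (mat (Suc n) (Suc n)
        (\<lambda>(i, j). e j (x i) * (\<Prod>l=j..<n. \<alpha> * x i + \<beta> l))) =
      det (mat (Suc n) (Suc n) (\<lambda>(i, j). e j (x i))) *
      det (mat (Suc n) (Suc n) (\<lambda>(i, j). U i j))"
    by (simp only: det_mat_sum_product)
  also have "det (mat (Suc n) (Suc n) (\<lambda>(i, j). e j (x i))) =
      (\<Prod>i\<le>n. \<Prod>l<i. x i - x l) * (\<Prod>j\<le>n. \<gamma> ^ j)"
    by (simp only: e_def det_newton_basis lessThan_Suc_atMost)
  also have "(\<Prod>j\<le>n. \<gamma> ^ j) = (\<Prod>j\<le>n. \<gamma> ^ (n - j))"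
    by (rule prod.reindex_bij_witness[of _ "\<lambda>j. n - j" "\<lambda>j. n - j"]) auto
  also have "det (mat (Suc n) (Suc n) (\<lambda>(i, j). U i j)) = (\<Prod>j\<le>n. U j j)"
    by (subst det_mat_lower_triangular) (auto simp: U_def lessThan_Suc_atMost simp del: prod.lessThan_Suc)
  also have "(\<Prod>i\<le>n. \<Prod>l<i. x i - x l) * (\<Prod>j\<le>n. \<gamma> ^ (n - j)) * (\<Prod>j\<le>n. U j j) =
      (\<Prod>i\<le>n. \<Prod>l<i. x i - x l) * (\<Prod>j\<le>n. \<gamma> ^ (n - j) * U j j)"
    by (simp only: prod.distrib mult.assoc)
  also have "(\<Prod>j\<le>n. \<gamma> ^ (n - j) * U j j) = (\<Prod>j\<le>n. \<Prod>l=j..<n. \<gamma> * \<beta> l - \<alpha> * c j)"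
  proof (intro prod.cong refl)
    fix j assume "j \<in> {..n}"
    then have "\<gamma> ^ (n - j) * U j j = (\<Prod>l=j..<n. \<gamma> * (\<beta> l - \<alpha> * c j / \<gamma>))"
      by (simp add: U_def u(2) prod.distrib)
    also have "\<dots> = (\<Prod>l=j..<n. \<gamma> * \<beta> l - \<alpha> * c j)"
      using assms by (intro prod.cong) (auto simp: field_simps)
    finally show "\<gamma> ^ (n - j) * U j j = (\<Prod>l=j..<n. \<gamma> * \<beta> l - \<alpha> * c j)" .
  qed
  finally show ?thesis by (simp only: e_def)
qed

section \<open>The determinant as a product over the staircase\<close>

lemma prod_falling_eq_fact_quotient:
  assumes "j \<le> n" "n \<le> Z"
  shows "(\<Prod>l=j..<n. of_nat Z - of_nat l) = (fact (Z - j) / fact (Z - n) :: 'a::field_char_0)"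
  using assms
proof (induction n rule: dec_induct)
  case base
  show ?case by simp
next
  case (step n)
  then have "Z - n = Suc (Z - Suc n)" "of_nat Z - of_nat n = (of_nat (Z - n) :: 'a)"
    by auto
  then show ?case using step
    by (simp add: prod.atLeastLessThan_Suc del: of_nat_Suc)
qed

text \<open>
  For \<open>j \<le> Y\<close> this is the factorial formula with the factorials completed to ones that do not depend on
  \<open>j\<close>. For \<open>j > Y\<close> both sides vanish, the right one because the first product contains the factor
  \<open>Y - Y\<close>; thus the linear forms also account for the entries that are zero by convention.
\<close>
lemma binomial_eq_linear_products:
  assumes "j \<le> n" "n \<le> m + Y"
  shows "of_nat ((m + Y - j) choose m) =
    fact (m + Y - n) / (fact m * fact Y) *
    ((\<Prod>l<j. of_nat Y - of_nat l) * (\<Prod>l=j..<n. of_nat (m + Y) - of_nat l :: 'a::field_char_0))"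
proof (cases "j \<le> Y")
  case True
  have low: "(\<Prod>l<j. of_nat Y - of_nat l) = (fact Y / fact (Y - j) :: 'a)"
    using prod_falling_eq_fact_quotient[of 0 j Y] True by (simp add: lessThan_atLeast0)
  have "of_nat ((m + Y - j) choose m) = (fact (m + Y - j) / (fact m * fact (Y - j)) :: 'a)"
    using True by (subst binomial_fact) auto
  then show ?thesis
    by (simp only: low prod_falling_eq_fact_quotient[OF assms]) simp
next
  case False
  then have "(\<Prod>l<j. of_nat Y - of_nat l) = (0 :: 'a)"
    by (auto simp: prod_zero_iff)
  moreover have "(m + Y - j) choose m = 0"
    using False assms by (intro binomial_eq_0) auto
  ultimately show ?thesis
    by (simp only: of_nat_0 mult_zero_left mult_zero_right)
qed

lemma prod_add_over_eq_fact_quotient: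
  "(\<Prod>i=1..M. (of_nat i + of_nat c) / of_nat i) =
    (fact (M + c) / (fact c * fact M) :: 'a::field_char_0)"
proof (induction M)
  case 0
  show ?case by simp
next
  case (Suc M)
  have "of_nat (Suc M) + of_nat c = (of_nat (Suc (M + c)) :: 'a)" by simp
  then show ?case
    using Suc.IH by (simp add: prod.nat_ivl_Suc' mult_ac del: of_nat_Suc)
qed

lemma upper_entry_reversed:
  assumes "y \<le> n" "j \<le> n" "1 \<le> r"
  shows "upper_entry n k r b p (n - y + 1) (n - j + 1) = k + (n - y) * r + (y * (p + 1) + b) - j"
proof -
  obtain d where d: "n = y + d" using le_Suc_ex[OF assms(1)] by blast
  have "d * 1 \<le> d * r" using assms(3) by (intro mult_le_mono2)
  then show ?thesis using assms(2) by (simp add: upper_entry_def d)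
qed

text \<open>
  Krattenthaler's formula with \<open>x y = y\<close>, where the first family of linear forms is
  \<open>Y - l = (p + 1) y + (b - l)\<close> and the second is
  \<open>m + Y - l = (p + 1 - r) y + (k + n r + b - l)\<close>. The Vandermonde product of the points \<open>0, \<dots>, n\<close>
  supplies the factorials of \<open>y\<close>. The columns are reversed because the formula needs the coefficient of
  \<open>y\<close> in the first family to be nonzero: \<open>p + 1\<close> never vanishes, while \<open>p + 1 - r\<close> may.
  The rows are reversed as well, which saves a sign.
\<close>
lemma D_eq_product:
  assumes "1 \<le> r"
  shows "D n k r b p =
    (\<Prod>y\<le>n. fact (k + (r - 1) * (n - y) + (b + y * p)) * fact y /
       (fact (k + (n - y) * r) * fact (y + (b + y * p)))) *
    (\<Prod>j\<le>n. \<Prod>l=j..<n. (rat_of_nat p + 1) * (of_nat k + of_nat n * of_nat r + of_nat b - of_nat l)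
       - (of_nat p + 1 - of_nat r) * (of_nat b - of_nat j))"
proof -
  define m where "m y = k + (n - y) * r" for y
  define Y where "Y y = y * (p + 1) + b" for y
  define a :: "nat \<Rightarrow> rat" where "a y = fact (m y + Y y - n) / (fact (m y) * fact (Y y))" for y
  define g :: "nat \<Rightarrow> nat \<Rightarrow> rat" where
    "g y j = (\<Prod>l<j. (of_nat p + 1) * of_nat y + (of_nat b - of_nat l)) *
      (\<Prod>l=j..<n. (of_nat p + 1 - of_nat r) * of_nat y +
         (of_nat k + of_nat n * of_nat r + of_nat b - of_nat l))" for y j
  have mY_diff: "m y + Y y - n = k + (r - 1) * (n - y) + (b + y * p)"
    and mY_ge: "n \<le> m y + Y y" if yn: "y \<le> n" for y
  proof -
    obtain r' where r': "r = Suc r'" using assms by (cases r) auto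
    obtain d where d: "n = y + d" using le_Suc_ex[OF yn] by blast
    show "m y + Y y - n = k + (r - 1) * (n - y) + (b + y * p)" "n \<le> m y + Y y"
      by (simp_all add: m_def Y_def r' d)
  qed
  have entry: "of_nat (upper_entry n k r b p (n - y + 1) (n - j + 1) choose m y) = a y * g y j"
    if "y \<le> n" "j \<le> n" for y j
  proof -
    have Y: "of_nat (Y y) - of_nat l = (of_nat p + 1) * of_nat y + (of_nat b - of_nat l :: rat)" for l
      by (simp add: Y_def algebra_simps)
    have my: "rat_of_nat (m y) = of_nat k + (of_nat n - of_nat y) * of_nat r"
      using that(1) by (simp only: m_def of_nat_add of_nat_mult of_nat_diff)
    have Z: "of_nat (m y + Y y) - of_nat l = (of_nat p + 1 - of_nat r) * of_nat y +
        (of_nat k + of_nat n * of_nat r + of_nat b - of_nat l :: rat)" for l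
      unfolding of_nat_add my by (simp add: Y_def algebra_simps)
    show ?thesis
      unfolding upper_entry_reversed[OF that assms] a_def g_def Y[symmetric] Z[symmetric]
      using binomial_eq_linear_products[OF that(2) mY_ge[OF that(1)]]
      by (simp only: m_def Y_def)
  qed
  have "D n k r b p = det (mat (Suc n) (Suc n)
      (\<lambda>(y, j). of_nat (upper_entry n k r b p (y + 1) (j + 1) choose (k + y * r))))"
    by (simp add: D_def D_matrix_def)
  also have "\<dots> = det (mat (Suc n) (Suc n)
      (\<lambda>(y, j). of_nat (upper_entry n k r b p (n - y + 1) (n - j + 1) choose m y)))"
    unfolding m_def
    by (rule det_mat_reverse[symmetric,
        where f = "\<lambda>y j. of_nat (upper_entry n k r b p (y + 1) (j + 1) choose (k + y * r))"])
  also have "mat (Suc n) (Suc n)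
      (\<lambda>(y, j). rat_of_nat (upper_entry n k r b p (n - y + 1) (n - j + 1) choose m y)) =
      mat (Suc n) (Suc n) (\<lambda>(y, j). a y * g y j)"
    by (intro eq_matI) (use entry in \<open>auto simp del: One_nat_def\<close>)
  also have "det \<dots> = (\<Prod>y\<le>n. a y) * det (mat (Suc n) (Suc n) (\<lambda>(y, j). g y j))"
    by (simp only: det_mat_scale_rows lessThan_Suc_atMost)
  also have "det (mat (Suc n) (Suc n) (\<lambda>(y, j). g y j)) =
      (\<Prod>y\<le>n. \<Prod>l<y. of_nat y - of_nat l) *
      (\<Prod>j\<le>n. \<Prod>l=j..<n. (rat_of_nat p + 1) * (of_nat k + of_nat n * of_nat r + of_nat b - of_nat l)
       - (of_nat p + 1 - of_nat r) * (of_nat b - of_nat j))"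
    unfolding g_def by (rule det_krattenthaler) (simp add: add_eq_0_iff flip: of_nat_Suc)
  also have "(\<Prod>y\<le>n. \<Prod>l<y. rat_of_nat y - of_nat l) = (\<Prod>y\<le>n. fact y)"
    using prod_falling_eq_fact_quotient[of 0, where 'a = rat] by (simp add: lessThan_atLeast0)
  also have "(\<Prod>y\<le>n. a y) * ((\<Prod>y\<le>n. fact y) * X) = (\<Prod>y\<le>n. a y * fact y) * X" for X
    by (simp add: prod.distrib)
  also have "(\<Prod>y\<le>n. a y * fact y) =
      (\<Prod>y\<le>n. fact (k + (r - 1) * (n - y) + (b + y * p)) * fact y /
       (fact (k + (n - y) * r) * fact (y + (b + y * p))))"
  proof (intro prod.cong refl)
    fix y assume "y \<in> {..n}"
    then have "a y = fact (k + (r - 1) * (n - y) + (b + y * p)) / (fact (m y) * fact (Y y))"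
      by (simp add: a_def mY_diff)
    moreover have "Y y = y + (b + y * p)" by (simp add: Y_def)
    ultimately show "a y * fact y = fact (k + (r - 1) * (n - y) + (b + y * p)) * fact y /
       (fact (k + (n - y) * r) * fact (y + (b + y * p)))"
      by (simp add: m_def)
  qed
  finally show ?thesis .
qed

section \<open>Redistribution of the factors\<close>

definition staircase :: "nat \<Rightarrow> (nat \<times> nat) set" where
  "staircase n = {(i, j). 1 \<le> i \<and> 1 \<le> j \<and> i + j \<le> n + 1}"

lemma finite_staircase: "finite (staircase n)"
  by (rule finite_subset[of _ "{..n + 1} \<times> {..n + 1}"]) (auto simp: staircase_def)

text \<open>
  The pair \<open>j \<le> l < n\<close> of linear forms belongs to the cell \<open>(l - j + 1, n - l)\<close>; in particular \<open>j\<close> indexes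
  the diagonals of the staircase.
\<close>
lemma prod_staircase:
  "(\<Prod>(i, j)\<in>staircase n. h i j) = (\<Prod>j\<le>n. \<Prod>l=j..<n. h (l - j + 1) (n - l))"
proof -
  have "(\<Prod>j\<le>n. \<Prod>l=j..<n. h (l - j + 1) (n - l)) =
      (\<Prod>(j, l)\<in>(SIGMA j:{..n}. {j..<n}). h (l - j + 1) (n - l))"
    by (rule prod.Sigma) auto
  also have "\<dots> = (\<Prod>(i, j)\<in>staircase n. h i j)"
    by (rule prod.reindex_bij_witness[of _ "\<lambda>(i, j). (n + 1 - i - j, n - j)"
          "\<lambda>(j, l). (l - j + 1, n - l)"]) (auto simp: staircase_def)
  finally show ?thesis by simp
qed

text \<open>
  The cells by which column \<open>j\<close> of \<open>A_set\<close> falls short: when its upper end \<open>k + (r - 1) * (n - j)\<close> lies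
  below \<open>j\<close>, they fill the range from that end up to \<open>j\<close>.
\<close>
definition deficit :: "nat \<Rightarrow> nat \<Rightarrow> nat \<Rightarrow> (nat \<times> nat) set" where
  "deficit n k r = {(i, j). j \<le> n \<and> k + (r - 1) * (n - j) < i \<and> i \<le> j}"

lemma finite_deficit: "finite (deficit n k r)"
  by (rule finite_subset[of _ "{..n} \<times> {..n}"]) (auto simp: deficit_def)

text \<open>
  In each column the initial segments of lengths \<open>k + (r - 1) * (n - j)\<close> and \<open>j\<close> are nested. Their
  common part \<open>C\<close> cancels; what is left of the first segment belongs to \<open>A_set\<close>, and what is left of the
  second to \<open>deficit\<close>.
\<close>
lemma prod_columns_eq_A_over_deficit:
  fixes f :: "nat \<Rightarrow> nat \<Rightarrow> 'a::field"
  assumes "\<And>i j. 1 \<le> i \<Longrightarrow> f i j \<noteq> 0"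
  shows "(\<Prod>j\<le>n. (\<Prod>i=1..k + (r - 1) * (n - j). f i j) / (\<Prod>i=1..j. f i j)) =
    (\<Prod>(i, j)\<in>A_set n k r. f i j) / (\<Prod>(i, j)\<in>deficit n k r. f i j)"
proof -
  define M where "M j = k + (r - 1) * (n - j)" for j
  define C where "C = {(i, j). j \<le> n \<and> 1 \<le> i \<and> i \<le> j \<and> i \<le> M j}"
  have fin: "finite C"
    by (rule finite_subset[of _ "{..n} \<times> {..n}"]) (auto simp: C_def)
  have cols: "(\<Prod>j\<le>n. \<Prod>i=1..N j. f i j) =
      (\<Prod>(i, j)\<in>{(i, j). j \<le> n \<and> 1 \<le> i \<and> i \<le> N j}. f i j)" for N :: "nat \<Rightarrow> nat"
  proof -
    have "(\<Prod>j\<le>n. \<Prod>i=1..N j. f i j) = (\<Prod>(j, i)\<in>(SIGMA j:{..n}. {1..N j}). f i j)"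
      by (rule prod.Sigma) auto
    also have "\<dots> = (\<Prod>(i, j)\<in>{(i, j). j \<le> n \<and> 1 \<le> i \<and> i \<le> N j}. f i j)"
      by (rule prod.reindex_bij_witness[of _ prod.swap prod.swap]) auto
    finally show ?thesis .
  qed
  have "{(i, j). j \<le> n \<and> 1 \<le> i \<and> i \<le> M j} = C \<union> A_set n k r"
    by (auto simp: C_def A_set_def M_def)
  moreover have "C \<inter> A_set n k r = {}"
    by (auto simp: C_def A_set_def)
  ultimately have num: "(\<Prod>j\<le>n. \<Prod>i=1..M j. f i j) =
      (\<Prod>(i, j)\<in>C. f i j) * (\<Prod>(i, j)\<in>A_set n k r. f i j)"
    using fin finite_A_set[of n k r] by (simp only: cols prod.union_disjoint)
  have "{(i, j). j \<le> n \<and> 1 \<le> i \<and> i \<le> j} = C \<union> deficit n k r"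
    by (auto simp: C_def deficit_def M_def)
  moreover have "C \<inter> deficit n k r = {}"
    by (auto simp: C_def deficit_def M_def)
  ultimately have den: "(\<Prod>j\<le>n. \<Prod>i=1..j. f i j) =
      (\<Prod>(i, j)\<in>C. f i j) * (\<Prod>(i, j)\<in>deficit n k r. f i j)"
    using fin finite_deficit[of n k r] by (simp only: cols prod.union_disjoint)
  have "(\<Prod>(i, j)\<in>C. f i j) \<noteq> 0"
    using fin assms by (auto simp: C_def prod_zero_iff)
  then show ?thesis
    unfolding prod_dividef M_def[symmetric] num den by simp
qed

text \<open>
  The cells of the staircase outside \<open>B_set\<close> have first coordinate \<open>k + 1 + r * s\<close>. Such a cell is matched with
  the cell of \<open>deficit\<close> in column \<open>n - s\<close> so that its diagonal \<open>i + j - 1\<close> equals \<open>s\<close> plus the first coordinate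
  of the deficit cell. The bound \<open>i + j \<le> n + 1\<close> then says that the latter is at most
  \<open>n - s\<close>, and \<open>1 \<le> j\<close> that it exceeds \<open>k + (r - 1) * s\<close>.
\<close>
lemma prod_staircase_eq_B_times_deficit:
  fixes h :: "nat \<Rightarrow> nat \<Rightarrow> 'a::comm_monoid_mult"
  assumes "1 \<le> r"
  shows "(\<Prod>(i, j)\<in>staircase n. h i j) = (\<Prod>(i, j)\<in>B_set n k r. h i j) *
    (\<Prod>(i, j)\<in>deficit n k r. h (k + 1 + r * (n - j)) (i + (n - j) - k - r * (n - j)))"
proof -
  define E where "E = {(i, j) \<in> staircase n. \<exists>s. i = k + 1 + r * s}"
  have "staircase n = B_set n k r \<union> E" "B_set n k r \<inter> E = {}"
    by (auto simp: staircase_def B_set_def E_def)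
  moreover have "finite E"
    using finite_staircase[of n] by (rule rev_finite_subset) (auto simp: E_def)
  ultimately have "(\<Prod>(i, j)\<in>staircase n. h i j) =
      (\<Prod>(i, j)\<in>B_set n k r. h i j) * (\<Prod>(i, j)\<in>E. h i j)"
    using finite_B_set[of n k r] by (simp only: prod.union_disjoint)
  also have "(\<Prod>(i, j)\<in>E. h i j) =
      (\<Prod>(i, j)\<in>deficit n k r. h (k + 1 + r * (n - j)) (i + (n - j) - k - r * (n - j)))"
  proof -
    obtain r' where r': "r = Suc r'" using assms by (cases r) auto
    define \<phi> where "\<phi> = (\<lambda>(i, j). (k + 1 + r * (n - j), i + (n - j) - k - r * (n - j)))"
    have "inj_on \<phi> (deficit n k r)"
    proof (rule inj_onI, clarify, rule conjI)
      fix i j i' j'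
      assume *: "(i, j) \<in> deficit n k r" "(i', j') \<in> deficit n k r" "\<phi> (i, j) = \<phi> (i', j')"
      have "n - j = n - j'" using *(3) assms by (simp add: \<phi>_def)
      then show "j = j'" using *(1,2) by (auto simp: deficit_def)
      then show "i = i'"
        using * by (auto simp: \<phi>_def deficit_def r')
    qed
    moreover have "\<phi> ` deficit n k r = E"
    proof (intro equalityI subsetI)
      fix z assume "z \<in> \<phi> ` deficit n k r"
      then show "z \<in> E"
        by (auto simp: \<phi>_def deficit_def E_def staircase_def r')
    next
      fix z assume "z \<in> E"
      then obtain s j where z: "z = (k + 1 + r * s, j)" "1 \<le> j" "k + 1 + r * s + j \<le> n + 1"
        unfolding E_def staircase_def by blast
      from z(3) have "s \<le> n" unfolding r' mult_Suc by linarith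
      then have "(k + r' * s + j, n - s) \<in> deficit n k r" "z = \<phi> (k + r' * s + j, n - s)"
        using z by (auto simp: \<phi>_def deficit_def r')
      then show "z \<in> \<phi> ` deficit n k r" by blast
    qed
    ultimately have "bij_betw \<phi> (deficit n k r) E"
      by (rule bij_betw_imageI)
    from prod.reindex_bij_betw[OF this, of "\<lambda>(i, j). h i j"] show ?thesis
      by (simp add: \<phi>_def case_prod_unfold)
  qed
  finally show ?thesis .
qed

theorem theorem5p9:
  fixes n k r p b :: nat
  assumes "n \<ge> 1" and "k \<ge> 1" and "r \<ge> 1" and "r \<le> p + 1"
  shows "D n k r b p =
    (\<Prod>(i, j)\<in>A_set n k r.
       (rat_of_nat i + rat_of_nat b + rat_of_nat j * rat_of_nat p) / rat_of_nat i) *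
    (\<Prod>(i, j)\<in>B_set n k r.
       ((rat_of_nat k - rat_of_nat i + 1) * (rat_of_nat p + 1)
          + (rat_of_nat i + rat_of_nat j - 1) * rat_of_nat r
          + rat_of_nat r * (rat_of_nat b + rat_of_nat n * rat_of_nat p))
       / (rat_of_nat k - rat_of_nat i + 1 + (rat_of_nat i + rat_of_nat j - 1) * rat_of_nat r))"
proof -
  define M where "M j = k + (r - 1) * (n - j)" for j
  define f where "f i j = (rat_of_nat i + of_nat b + of_nat j * of_nat p) / of_nat i" for i j
  define num where "num i j = (rat_of_nat k - of_nat i + 1) * (of_nat p + 1)
      + (of_nat i + of_nat j - 1) * of_nat r + of_nat r * (of_nat b + of_nat n * of_nat p)" for i j
  define den where "den i j =
      rat_of_nat k - of_nat i + 1 + (of_nat i + of_nat j - 1) * of_nat r" for i j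
  have M: "k + (n - j) * r = M j + (n - j)" for j
    using assms(3) by (cases r) (simp_all add: M_def)
  have f_nonzero: "f i j \<noteq> 0" if "1 \<le> i" for i j
    using that by (simp add: f_def add_eq_0_iff flip: of_nat_add of_nat_mult)

  have numerators: "(\<Prod>j\<le>n. \<Prod>l=j..<n.
      (rat_of_nat p + 1) * (of_nat k + of_nat n * of_nat r + of_nat b - of_nat l)
       - (of_nat p + 1 - of_nat r) * (of_nat b - of_nat j)) = (\<Prod>(i, j)\<in>staircase n. num i j)"
    unfolding prod_staircase
    by (intro prod.cong refl) (auto simp: num_def of_nat_diff algebra_simps)
  have denominators: "(\<Prod>(i, j)\<in>staircase n. den i j) =
      (\<Prod>j\<le>n. fact (k + (n - j) * r) / fact (M j))"
    unfolding prod_staircase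
  proof (intro prod.cong refl)
    fix j assume j: "j \<in> {..n}"
    have m: "rat_of_nat (k + (n - j) * r) = of_nat k + (of_nat n - of_nat j) * of_nat r"
      using j by (simp only: of_nat_add of_nat_mult of_nat_diff atMost_iff)
    have "(\<Prod>l=j..<n. den (l - j + 1) (n - l)) =
        (\<Prod>l=0..<n-j. of_nat (k + (n - j) * r) - of_nat l)"
    proof (rule prod.reindex_bij_witness[of _ "\<lambda>l. l + j" "\<lambda>l. l - j"])
      fix l assume "l \<in> {j..<n}"
      then show "of_nat (k + (n - j) * r) - of_nat (l - j) = den (l - j + 1) (n - l)"
        unfolding m den_def by (simp add: of_nat_diff algebra_simps)
    qed auto
    then show "(\<Prod>l=j..<n. den (l - j + 1) (n - l)) = fact (k + (n - j) * r) / fact (M j)"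
      using prod_falling_eq_fact_quotient[of 0 "n - j" "k + (n - j) * r", where 'a = rat] M[of j]
      by simp
  qed
  \<comment> \<open>The row factor of the determinant is a quotient of two initial column products of \<open>f\<close>, divided by the
    product of the denominators along one diagonal of the staircase.\<close>
  have columns: "fact (M j + (b + j * p)) * fact j / (fact (k + (n - j) * r) * fact (j + (b + j * p))) =
      (\<Prod>i=1..M j. f i j) / (\<Prod>i=1..j. f i j) / (fact (k + (n - j) * r) / fact (M j))" for j
  proof -
    have f_prod: "(\<Prod>i=1..N. f i j) = fact (N + (b + j * p)) / (fact (b + j * p) * fact N)" for N
      using prod_add_over_eq_fact_quotient[where 'a = rat, of "b + j * p" N]
      by (simp add: f_def add.assoc)
    show ?thesis unfolding f_prod by (simp add: field_simps)
  qed
  \<comment> \<open>On the excluded rows numerator and denominator share the factor \<open>r\<close>.\<close>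
  have excluded: "num (k + 1 + r * (n - j)) (i + (n - j) - k - r * (n - j)) /
      den (k + 1 + r * (n - j)) (i + (n - j) - k - r * (n - j)) = f i j"
    if "(i, j) \<in> deficit n k r" for i j
  proof -
    obtain r' where r': "r = Suc r'" using assms(3) by (cases r) auto
    define s where "s = n - j"
    have n: "n = j + s" and i: "k + r' * s < i"
      using that by (auto simp: deficit_def s_def r')
    then have j: "rat_of_nat (i + s - k - r * s) = of_nat i + of_nat s - of_nat k - of_nat r * of_nat s"
      by (simp add: of_nat_diff r' algebra_simps)
    have "num (k + 1 + r * s) (i + s - k - r * s) =
        of_nat r * (of_nat i + of_nat b + of_nat j * of_nat p)"
      unfolding num_def j by (simp add: n algebra_simps)
    moreover have "den (k + 1 + r * s) (i + s - k - r * s) = of_nat r * of_nat i"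
      unfolding den_def j by (simp add: algebra_simps)
    ultimately show ?thesis
      using assms(3) by (simp add: f_def s_def)
  qed

  have "D n k r b p = (\<Prod>j\<le>n. (\<Prod>i=1..M j. f i j) / (\<Prod>i=1..j. f i j)) /
      (\<Prod>(i, j)\<in>staircase n. den i j) * (\<Prod>(i, j)\<in>staircase n. num i j)"
    by (simp only: D_eq_product[OF assms(3)] numerators denominators M_def[symmetric] columns
        prod_dividef)
  also have "\<dots> = (\<Prod>(i, j)\<in>A_set n k r. f i j) / (\<Prod>(i, j)\<in>deficit n k r. f i j) *
      (\<Prod>(i, j)\<in>staircase n. num i j / den i j)"
    using prod_columns_eq_A_over_deficit[of f, OF f_nonzero, where n = n and k = k and r = r]
    by (simp add: M_def case_prod_unfold prod_dividef)
  also have "(\<Prod>(i, j)\<in>staircase n. num i j / den i j) =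
      (\<Prod>(i, j)\<in>B_set n k r. num i j / den i j) * (\<Prod>(i, j)\<in>deficit n k r. f i j)"
    unfolding prod_staircase_eq_B_times_deficit[OF assms(3), where k = k]
    using excluded by (intro arg_cong2[where f = "(*)"] prod.cong refl) auto
  also have "(\<Prod>(i, j)\<in>A_set n k r. f i j) / (\<Prod>(i, j)\<in>deficit n k r. f i j) *
      ((\<Prod>(i, j)\<in>B_set n k r. num i j / den i j) * (\<Prod>(i, j)\<in>deficit n k r. f i j)) =
      (\<Prod>(i, j)\<in>A_set n k r. f i j) * (\<Prod>(i, j)\<in>B_set n k r. num i j / den i j)"
  proof -
    have "(\<Prod>(i, j)\<in>deficit n k r. f i j) \<noteq> 0"
      using finite_deficit f_nonzero by (auto simp: prod_zero_iff deficit_def)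
    then show ?thesis by simp
  qed
  finally show ?thesis by (simp only: f_def num_def den_def)
qed

end
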